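(* Let $\mathcal{B}_n(P)$ denote the set of t-shelves of size $n$ in which no node that is a left child of its parent has a left child itself (i.e. t-shelves avoiding the pattern $P$ given by the size-3 t-shelf with root $1$, left child $2$, and $3$ the left child of $2$). Let $e_{n,k}$ be the number of t-shelves in $\mathcal{B}_n(P)$ having exactly $k$ left children. Then $$\sum_{n\ge0}\sum_{k\ge0} e_{n,k}\frac{z^ny^k}{n!} = \frac{2y-1}{y\cosh\left(z\sqrt{1-2y}+\ln\left(\frac{1}{y}\left(y+\sqrt{1-2y}-1\right)\right)\right)+y}.$$
   Context: A treeshelf (t-shelf) of size $n\ge 1$ is a rooted binary tree with $n$ nodes labeled bijectively by $\{1,\dots,n\}$ so that labels strictly increase along every path starting at the root, in which every node has at most one left child and at most one right child, and every child (including a child with no sibling) is designated either as the left child or the right child of its parent. There is a unique empty t-shelf, of size $0$. A left child is a node that is the left child of its parent; the number of left children of a t-shelf is the number of such nodes. *)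

theory Defs
  imports "HOL-Analysis.Analysis" "HOL-Library.Tree"
begin

fun increasing :: "nat tree \<Rightarrow> bool" where
  "increasing Leaf = True"
| "increasing (Node l a r) =
     ((\<forall>x \<in> set_tree l \<union> set_tree r. a < x) \<and> increasing l \<and> increasing r)"

text \<open>The inorder list contains the label of each node exactly once, so its distinctness says that
  different nodes carry different labels.\<close>

definition treeshelf :: "nat \<Rightarrow> nat tree \<Rightarrow> bool" where
  "treeshelf n t \<longleftrightarrow>
     size t = n \<and> set_tree t = {1..n} \<and> distinct (inorder t) \<and> increasing t"

fun left_children :: "nat tree \<Rightarrow> nat" where
  "left_children Leaf = 0"
| "left_children (Node l a r) =
     (if l = Leaf then 0 else 1) + left_children l + left_children r"

fun avoids_P :: "nat tree \<Rightarrow> bool" where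
  "avoids_P Leaf = True"
| "avoids_P (Node l a r) =
     ((case l of Leaf \<Rightarrow> True | Node ll b lr \<Rightarrow> ll = Leaf) \<and> avoids_P l \<and> avoids_P r)"

definition BP :: "nat \<Rightarrow> nat tree set" where
  "BP n = {t. treeshelf n t \<and> avoids_P t}"

definition e :: "nat \<Rightarrow> nat \<Rightarrow> nat" where
  "e n k = card {t \<in> BP n. left_children t = k}"

end

theory Submission imports Defs begin

text \<open>For a fixed \<open>y\<close>, let \<open>B\<close> be the exponential generating function in \<open>z\<close> of the
  \<open>P\<close>-avoiding t-shelves and \<open>L\<close> that of the shelves that may be hung on the left below a root
  (the empty one, or those whose root has no left child, with an extra factor \<open>y\<close>).
  Removing the node of smallest label gives \<open>B' = L * B\<close> and \<open>L' = y * B\<close>, hence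
  \<open>L\<^sup>2 = 2 * y * B + 1 - 2 * y\<close>. If \<open>D\<close> is the denominator of the closed form and
  \<open>s\<^sup>2 = 1 - 2 * y\<close>, then \<open>D'' = s\<^sup>2 * (D - y)\<close>, and the pair
  \<open>G = B * D + s\<^sup>2\<close>, \<open>F = L * D + D'\<close> solves the homogeneous linear system
  \<open>G' = B * F\<close>, \<open>F' = L * F - y * G\<close> with zero initial values. So \<open>G = 0\<close>.\<close>

section \<open>Decomposition at the smallest label\<close>

text \<open>Arbitrary finite label sets are allowed because the two subtrees below a root rarely
  carry an initial segment of labels; this avoids relabelling.\<close>

definition shelves_on :: "nat set \<Rightarrow> nat tree set" where
  "shelves_on S = {t. set_tree t = S \<and> distinct (inorder t) \<and> increasing t \<and> avoids_P t}"

text \<open>These are exactly the trees that may be hung as a left subtree. The empty one is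
  included since \<open>left Leaf = Leaf\<close>.\<close>

definition left_shelves_on :: "nat set \<Rightarrow> nat tree set" where
  "left_shelves_on S = {t \<in> shelves_on S. left t = Leaf}"

lemma avoids_P_Node: "avoids_P (Node l a r) \<longleftrightarrow> left l = Leaf \<and> avoids_P l \<and> avoids_P r"
  by (cases l) auto

lemma BP_eq_shelves_on: "BP n = shelves_on {1..n}"
proof -
  have "size t = n" if "set_tree t = {1..n}" "distinct (inorder t)" for t :: "nat tree"
    using that distinct_card[of "inorder t"] by (simp flip: length_inorder set_inorder)
  then show ?thesis
    by (auto simp: BP_def treeshelf_def shelves_on_def)
qed

lemma shelves_on_empty: "shelves_on {} = {Leaf}"
  by (auto simp: shelves_on_def)

lemma left_shelves_on_empty: "left_shelves_on {} = {Leaf}"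
  by (auto simp: left_shelves_on_def shelves_on_empty)

lemma Node_mem_shelves_on_iff:
  "Node l a r \<in> shelves_on S \<longleftrightarrow>
     S = insert a (set_tree l \<union> set_tree r) \<and> (\<forall>x \<in> set_tree l \<union> set_tree r. a < x) \<and>
     set_tree l \<inter> set_tree r = {} \<and>
     l \<in> left_shelves_on (set_tree l) \<and> r \<in> shelves_on (set_tree r)"
  by (auto simp: shelves_on_def left_shelves_on_def avoids_P_Node simp del: avoids_P.simps(2))

lemma shelves_on_root:
  assumes "S \<noteq> {}" "t \<in> shelves_on S"
  obtains l r where "t = Node l (Min S) r"
proof (cases t)
  case Leaf
  with assms show ?thesis by (auto simp: shelves_on_def)
next
  case (Node l a r)
  with assms have "Min S = a"
    by (auto simp: Node_mem_shelves_on_iff intro!: Min_eqI intro: less_imp_le)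
  with Node that show ?thesis by blast
qed

lemma Min_less_if_mem_Diff:
  fixes S :: "'a::linorder set"
  shows "finite S \<Longrightarrow> x \<in> S - {Min S} \<Longrightarrow> Min S < x"
  by (metis DiffE Min_le insertI1 order_le_less)

text \<open>Labels increase downwards, so the root carries \<open>Min S\<close>; the other labels
  split freely between the subtrees, and avoidance at the root constrains only the left one. The
  component \<open>U\<close> is redundant data (it is \<open>set_tree l\<close>), kept so that the
  index set is fibred over label subsets.\<close>

lemma shelves_on_decomp:
  assumes "finite S" "S \<noteq> {}"
  shows "bij_betw (\<lambda>(U, l, r). Node l (Min S) r)
           (SIGMA U : Pow (S - {Min S}). left_shelves_on U \<times> shelves_on (S - {Min S} - U))
           (shelves_on S)"
    (is "bij_betw ?f ?A _")
proof (rule bij_betwI')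
  fix p q assume "p \<in> ?A" "q \<in> ?A"
  then show "?f p = ?f q \<longleftrightarrow> p = q"
    by (auto simp: left_shelves_on_def shelves_on_def)
next
  fix p assume p: "p \<in> ?A"
  obtain U l r where [simp]: "p = (U, l, r)" by (cases p)
  have lr: "set_tree l = U" "set_tree r = S - {Min S} - U" "U \<subseteq> S - {Min S}"
    using p by (auto simp: left_shelves_on_def shelves_on_def)
  have un: "set_tree l \<union> set_tree r = S - {Min S}" using lr by auto
  have "\<forall>x \<in> set_tree l \<union> set_tree r. Min S < x" "S = insert (Min S) (set_tree l \<union> set_tree r)"
    unfolding un using assms Min_less_if_mem_Diff[OF assms(1)] Min_in[OF assms] by blast+
  moreover have "set_tree l \<inter> set_tree r = {}" using lr by auto
  ultimately show "?f p \<in> shelves_on S"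
    using p lr by (simp add: Node_mem_shelves_on_iff)
next
  fix t assume t: "t \<in> shelves_on S"
  then obtain l r where [simp]: "t = Node l (Min S) r"
    using assms by (metis shelves_on_root)
  define m where "m = Min S"
  have *: "S = insert m (set_tree l \<union> set_tree r)" "\<forall>x \<in> set_tree l \<union> set_tree r. m < x"
    "set_tree l \<inter> set_tree r = {}"
    "l \<in> left_shelves_on (set_tree l)" "r \<in> shelves_on (set_tree r)"
    using t by (auto simp: Node_mem_shelves_on_iff m_def)
  then have "set_tree r = S - {m} - set_tree l" "set_tree l \<subseteq> S - {m}"
    by auto
  with * have "(set_tree l, l, r) \<in> ?A" by (auto simp flip: m_def)
  then show "\<exists>p \<in> ?A. t = ?f p" by force
qed

text \<open>With no left child at the root, all other labels form the right subtree, and a right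
  child is free to have a left child.\<close>

lemma left_shelves_on_decomp:
  assumes "finite S" "S \<noteq> {}"
  shows "bij_betw (Node Leaf (Min S)) (shelves_on (S - {Min S})) (left_shelves_on S)"
proof (rule bij_betwI')
  fix r assume r: "r \<in> shelves_on (S - {Min S})"
  then have set_r: "set_tree r = S - {Min S}" by (auto simp: shelves_on_def)
  have "\<forall>x \<in> set_tree r. Min S < x" "S = insert (Min S) (set_tree r)"
    unfolding set_r using assms Min_less_if_mem_Diff[OF assms(1)] Min_in[OF assms] by blast+
  then show "Node Leaf (Min S) r \<in> left_shelves_on S"
    using r set_r
    by (simp add: left_shelves_on_def[of S] Node_mem_shelves_on_iff left_shelves_on_empty)
next
  fix t assume t: "t \<in> left_shelves_on S"
  then obtain r where [simp]: "t = Node Leaf (Min S) r"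
    using assms by (metis (mono_tags, lifting) left.simps(1) left_shelves_on_def mem_Collect_eq
        shelves_on_root)
  define m where "m = Min S"
  have *: "S = insert m (set_tree r)" "\<forall>x \<in> set_tree r. m < x" "r \<in> shelves_on (set_tree r)"
    using t by (auto simp: left_shelves_on_def[of S] Node_mem_shelves_on_iff m_def)
  then have "S - {m} = set_tree r" by auto
  with *(3) show "\<exists>r \<in> shelves_on (S - {Min S}). t = Node Leaf (Min S) r"
    by (auto simp flip: m_def)
qed auto

lemma finite_shelves_on: "finite S \<Longrightarrow> finite (shelves_on S)"
proof (induction S rule: finite_psubset_induct)
  case (psubset S)
  show ?case
  proof (cases "S = {}")
    case False
    have *: "U \<subset> S" if "U \<subseteq> S - {Min S}" for U
      using that Min_in[OF psubset.hyps False] by auto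
    have "finite (SIGMA U : Pow (S - {Min S}). left_shelves_on U \<times> shelves_on (S - {Min S} - U))"
      using psubset by (intro finite_SigmaI finite_cartesian_product)
        (auto simp: left_shelves_on_def intro!: psubset.IH * )
    then show ?thesis
      using bij_betw_finite[OF shelves_on_decomp[OF psubset.hyps False]] by blast
  qed (simp add: shelves_on_empty)
qed

section \<open>Weighted enumeration\<close>

definition shelf_weight :: "'a::comm_semiring_1 \<Rightarrow> nat set \<Rightarrow> 'a" where
  "shelf_weight y S = (\<Sum>t\<in>shelves_on S. y ^ left_children t)"

text \<open>The extra factor \<open>y\<close> counts the root of a nonempty \<open>t\<close>, which
  becomes a left child once \<open>t\<close> is hung on the left.\<close>

definition left_shelf_weight :: "'a::comm_semiring_1 \<Rightarrow> nat set \<Rightarrow> 'a" where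
  "left_shelf_weight y S =
     (\<Sum>t\<in>left_shelves_on S. y ^ ((if t = Leaf then 0 else 1) + left_children t))"

definition shelf_poly :: "'a::comm_semiring_1 \<Rightarrow> nat \<Rightarrow> 'a" where
  "shelf_poly y n = shelf_weight y {1..n}"

text \<open>The common value of \<open>left_shelf_weight y\<close> on all label sets of size
  \<open>n\<close>, read off from the decomposition of left shelves.\<close>

definition left_shelf_poly :: "'a::comm_semiring_1 \<Rightarrow> nat \<Rightarrow> 'a" where
  "left_shelf_poly y n = (case n of 0 \<Rightarrow> 1 | Suc m \<Rightarrow> y * shelf_poly y m)"

lemma shelf_weight_decomp:
  assumes "finite S" "S \<noteq> {}"
  shows "shelf_weight y S =
    (\<Sum>U\<in>Pow (S - {Min S}). left_shelf_weight y U * shelf_weight y (S - {Min S} - U))"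
proof -
  let ?A = "SIGMA U : Pow (S - {Min S}). left_shelves_on U \<times> shelves_on (S - {Min S} - U)"
  have fin: "finite (shelves_on U)" "finite (left_shelves_on U)" if "U \<subseteq> S" for U
    using that assms finite_shelves_on[of U] by (auto simp: left_shelves_on_def dest: finite_subset)
  have "shelf_weight y S = (\<Sum>(U, l, r)\<in>?A. y ^ left_children (Node l (Min S) r))"
    unfolding shelf_weight_def
    by (subst sum.reindex_bij_betw[OF shelves_on_decomp[OF assms], symmetric])
      (simp add: case_prod_unfold)
  also have "\<dots> = (\<Sum>(U, l, r)\<in>?A.
      y ^ ((if l = Leaf then 0 else 1) + left_children l) * y ^ left_children r)"
    by (intro sum.cong) (auto simp: power_add)
  also have "\<dots> = (\<Sum>U\<in>Pow (S - {Min S}). \<Sum>(l, r)\<in>left_shelves_on U \<times> shelves_on (S - {Min S} - U).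
      y ^ ((if l = Leaf then 0 else 1) + left_children l) * y ^ left_children r)"
    using assms by (intro sum.Sigma[symmetric] ballI finite_cartesian_product fin) auto
  also have "\<dots> = (\<Sum>U\<in>Pow (S - {Min S}). left_shelf_weight y U * shelf_weight y (S - {Min S} - U))"
    unfolding left_shelf_weight_def shelf_weight_def
    by (simp only: sum_product sum.cartesian_product)
  finally show ?thesis .
qed

lemma left_shelf_weight_empty: "left_shelf_weight y {} = 1"
  by (simp add: left_shelf_weight_def left_shelves_on_empty)

lemma left_shelf_weight_decomp:
  assumes "finite S" "S \<noteq> {}"
  shows "left_shelf_weight y S = y * shelf_weight y (S - {Min S})"
  unfolding left_shelf_weight_def shelf_weight_def
  by (subst sum.reindex_bij_betw[OF left_shelves_on_decomp[OF assms], symmetric])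
    (simp add: sum_distrib_left)

lemma sum_Pow_card:
  fixes g :: "nat \<Rightarrow> 'a::comm_semiring_1"
  assumes "finite A"
  shows "(\<Sum>U\<in>Pow A. g (card U)) = (\<Sum>j\<le>card A. of_nat (card A choose j) * g j)"
proof -
  have "(\<Sum>U\<in>Pow A. g (card U)) = (\<Sum>j\<le>card A. \<Sum>U\<in>{U \<in> Pow A. card U = j}. g (card U))"
    using assms by (intro sum.group[symmetric]) (auto intro: card_mono)
  also have "\<dots> = (\<Sum>j\<le>card A. of_nat (card A choose j) * g j)"
    using n_subsets[OF assms] by (intro sum.cong) auto
  finally show ?thesis .
qed

text \<open>The two claims need a joint induction: the recursion requires that weights of smaller
  label sets depend only on cardinality, and the recursion in turn expresses the weight of
  \<open>S\<close> through \<open>card S\<close> alone.\<close>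

lemma shelf_weight_eq_and_rec:
  fixes y :: "'a::comm_semiring_1"
  shows "(\<forall>S. finite S \<longrightarrow> card S = n \<longrightarrow> shelf_weight y S = shelf_poly y n) \<and>
    (\<forall>m. n = Suc m \<longrightarrow> shelf_poly y n =
      (\<Sum>j\<le>m. of_nat (m choose j) * (left_shelf_poly y j * shelf_poly y (m - j))))"
proof (induction n rule: less_induct)
  case (less n)
  show ?case
  proof (cases n)
    case 0
    then show ?thesis by (auto simp: shelf_poly_def)
  next
    case (Suc m)
    have rec: "shelf_weight y S =
        (\<Sum>j\<le>m. of_nat (m choose j) * (left_shelf_poly y j * shelf_poly y (m - j)))"
      if S: "finite S" "card S = n" for S
    proof -
      let ?S = "S - {Min S}"
      have ne: "S \<noteq> {}" using S Suc by auto
      have card: "card ?S = m" using S Suc Min_in[OF S(1) ne] by simp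
      have left: "left_shelf_weight y U = left_shelf_poly y (card U)" if "U \<subseteq> ?S" for U
      proof (cases "U = {}")
        case True
        then show ?thesis by (simp add: left_shelf_weight_empty left_shelf_poly_def)
      next
        case False
        have U: "finite U" "card U \<le> m"
          using that S(1) card card_mono[of ?S U] by (auto dest: finite_subset)
        then obtain k where k: "card U = Suc k" "k < n"
          using False Suc by (cases "card U") auto
        then show ?thesis
          using less.IH[of k] U False Min_in[OF U(1) False]
          by (simp add: left_shelf_weight_decomp left_shelf_poly_def)
      qed
      have right: "shelf_weight y (?S - U) = shelf_poly y (m - card U)" if "U \<subseteq> ?S" for U
      proof -
        have "card (?S - U) = m - card U"
          using that S(1) card by (metis card_Diff_subset finite_Diff finite_subset)
        then show ?thesis using less.IH[of "m - card U"] S(1) Suc by auto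
      qed
      have "shelf_weight y S =
          (\<Sum>U\<in>Pow ?S. left_shelf_poly y (card U) * shelf_poly y (m - card U))"
        by (subst shelf_weight_decomp[OF S(1) ne], intro sum.cong) (auto simp: left right)
      also have "\<dots> = (\<Sum>j\<le>m. of_nat (m choose j) * (left_shelf_poly y j * shelf_poly y (m - j)))"
        using sum_Pow_card[of ?S "\<lambda>j. left_shelf_poly y j * shelf_poly y (m - j)"] S(1) card by simp
      finally show ?thesis .
    qed
    \<comment> \<open>The instance \<open>{1..n}\<close> is the recursion for
      \<open>shelf_poly\<close>; every other \<open>S\<close> of the same size has the same
      right-hand side.\<close>
    from rec[of "{1..n}"] rec Suc show ?thesis by (simp add: shelf_poly_def)
  qed
qed

lemma shelf_poly_0: "shelf_poly y 0 = 1"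
  by (simp add: shelf_poly_def shelf_weight_def shelves_on_empty)

lemma shelf_poly_Suc:
  "shelf_poly y (Suc m) =
    (\<Sum>j\<le>m. of_nat (m choose j) * (left_shelf_poly y j * shelf_poly y (m - j)))"
  using shelf_weight_eq_and_rec by blast

lemma e_eq_0: "k \<notin> left_children ` BP n \<Longrightarrow> e n k = 0"
  unfolding e_def card_eq_0_iff by auto

lemma finite_BP: "finite (BP n)"
  by (simp add: BP_eq_shelves_on finite_shelves_on)

lemma sum_e_eq_shelf_poly:
  fixes y :: "'a::comm_semiring_1"
  shows "(\<Sum>k\<in>left_children ` BP n. of_nat (e n k) * y ^ k) = shelf_poly y n"
proof -
  have "(\<Sum>k\<in>left_children ` BP n. of_nat (e n k) * y ^ k) =
      (\<Sum>k\<in>left_children ` BP n. \<Sum>t\<in>{t \<in> BP n. left_children t = k}. y ^ left_children t)"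
    by (intro sum.cong) (auto simp: e_def)
  also have "\<dots> = (\<Sum>t\<in>BP n. y ^ left_children t)"
    using finite_BP by (intro sum.group) auto
  finally show ?thesis
    by (simp add: shelf_poly_def shelf_weight_def BP_eq_shelves_on)
qed

section \<open>Growth of the weight polynomials\<close>

lemma shelf_poly_nonneg: "0 \<le> y \<Longrightarrow> 0 \<le> shelf_poly (y :: real) n"
  by (auto simp: shelf_poly_def shelf_weight_def intro: sum_nonneg)

text \<open>The recursion reproduces the bound: the binomial coefficient cancels the factorials, so
  each of the \<open>m + 1\<close> summands is at most \<open>fact m * M ^ m\<close>. This yields
  convergence of the generating function for |z| < 1/M.\<close>

lemma shelf_poly_le:
  fixes y M :: real
  assumes "0 \<le> y" "y \<le> M" "1 \<le> M"
  shows "shelf_poly y n \<le> fact n * M ^ n"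
proof (induction n rule: less_induct)
  case (less n)
  show ?case
  proof (cases n)
    case 0
    then show ?thesis by (simp add: shelf_poly_0)
  next
    case (Suc m)
    have left: "0 \<le> left_shelf_poly y j \<and> left_shelf_poly y j \<le> fact j * M ^ j" if "j \<le> m" for j
    proof (cases j)
      case (Suc i)
      have "y * shelf_poly y i \<le> M * (fact i * M ^ i)"
        using less.IH[of i] that Suc \<open>n = Suc m\<close> assms shelf_poly_nonneg by (intro mult_mono) auto
      also have "\<dots> = fact i * M ^ j" using Suc by simp
      also have "\<dots> \<le> fact j * M ^ j"
        using Suc assms by (intro mult_right_mono fact_mono) auto
      finally show ?thesis
        using Suc assms shelf_poly_nonneg by (simp add: left_shelf_poly_def)
    qed (simp add: left_shelf_poly_def)
    have "shelf_poly y n \<le> (\<Sum>j\<le>m. (m choose j) * ((fact j * M ^ j) * (fact (m - j) * M ^ (m - j))))"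
      unfolding Suc shelf_poly_Suc
      using left less.IH Suc assms
      by (intro sum_mono mult_left_mono mult_mono shelf_poly_nonneg) auto
    also have "\<dots> = (\<Sum>j\<le>m. fact m * M ^ m)"
    proof (intro sum.cong refl)
      fix j assume "j \<in> {..m}"
      then have "(m choose j) * (fact j * fact (m - j)) = (fact m :: real)" "M ^ m = M ^ j * M ^ (m - j)"
        by (simp_all add: binomial_fact flip: power_add)
      then show "(m choose j) * ((fact j * M ^ j) * (fact (m - j) * M ^ (m - j))) = fact m * M ^ m"
        by (simp add: algebra_simps)
    qed
    also have "\<dots> = fact n * M ^ m" using Suc by (simp add: algebra_simps)
    also have "\<dots> \<le> fact n * M ^ n"
      using Suc assms by (intro mult_left_mono power_increasing) auto
    finally show ?thesis .
  qed
qed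

section \<open>The generating function\<close>

definition shelf_fps :: "complex \<Rightarrow> complex fps" where
  "shelf_fps y = Abs_fps (\<lambda>n. shelf_poly y n / fact n)"

definition left_shelf_fps :: "complex \<Rightarrow> complex fps" where
  "left_shelf_fps y = Abs_fps (\<lambda>n. left_shelf_poly y n / fact n)"

lemma fps_deriv_left_shelf_fps: "fps_deriv (left_shelf_fps y) = fps_const y * shelf_fps y"
  by (rule fps_ext)
    (simp add: left_shelf_fps_def shelf_fps_def left_shelf_poly_def field_simps del: of_nat_Suc)

lemma fps_deriv_shelf_fps: "fps_deriv (shelf_fps y) = left_shelf_fps y * shelf_fps y"
proof (rule fps_ext)
  fix n
  have "fps_nth (fps_deriv (shelf_fps y)) n = shelf_poly y (Suc n) / fact n"
    by (simp add: shelf_fps_def field_simps del: of_nat_Suc)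
  also have "\<dots> = (\<Sum>j\<le>n. left_shelf_poly y j / fact j * (shelf_poly y (n - j) / fact (n - j)))"
    unfolding shelf_poly_Suc sum_divide_distrib
    by (intro sum.cong refl) (simp add: binomial_fact field_simps)
  also have "\<dots> = fps_nth (left_shelf_fps y * shelf_fps y) n"
    by (simp add: fps_mult_nth left_shelf_fps_def shelf_fps_def atLeast0AtMost)
  finally show "fps_nth (fps_deriv (shelf_fps y)) n = fps_nth (left_shelf_fps y * shelf_fps y) n" .
qed

lemma shelf_fps_nth_0: "fps_nth (shelf_fps y) 0 = 1" "fps_nth (left_shelf_fps y) 0 = 1"
  by (simp_all add: shelf_fps_def left_shelf_fps_def shelf_poly_0 left_shelf_poly_def)

text \<open>Both sides have derivative 2yLB and constant term 1.\<close>

lemma left_shelf_fps_square: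
  "left_shelf_fps y ^ 2 = fps_const (2 * y) * shelf_fps y + fps_const (1 - 2 * y)"
proof -
  have "fps_deriv (left_shelf_fps y ^ 2) = fps_deriv (fps_const (2 * y) * shelf_fps y)"
    by (simp add: power2_eq_square fps_deriv_left_shelf_fps fps_deriv_shelf_fps
        flip: fps_const_mult numeral_fps_const)
  then show ?thesis
    unfolding fps_deriv_eq_iff by (simp add: shelf_fps_nth_0 power2_eq_square)
qed

text \<open>Uniqueness for linear systems: the system determines coefficient \<open>Suc m\<close> of
  \<open>G\<close> and \<open>F\<close> linearly from the coefficients up to \<open>m\<close>, so
  zero initial values propagate.\<close>

lemma fps_linear_system_eq_0:
  fixes F G :: "'a::field_char_0 fps"
  assumes "fps_deriv G = a * G + b * F" "fps_deriv F = c * G + d * F" "fps_nth G 0 = 0" "fps_nth F 0 = 0"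
  shows "G = 0" "F = 0"
proof -
  have "fps_nth G n = 0 \<and> fps_nth F n = 0" for n
  proof (induction n rule: less_induct)
    case (less n)
    show ?case
    proof (cases n)
      case (Suc m)
      have "fps_nth (a * G + b * F) m = 0" "fps_nth (c * G + d * F) m = 0"
        using less.IH Suc by (auto simp: fps_mult_nth)
      then have "fps_nth (fps_deriv G) m = 0" "fps_nth (fps_deriv F) m = 0"
        using assms by simp_all
      then show ?thesis using Suc by (simp del: of_nat_Suc)
    qed (use assms in simp)
  qed
  then show "G = 0" "F = 0" by (auto intro: fps_ext)
qed

text \<open>The denominator y cosh(zs + ln w) + y with w = (y + s - 1)/y, expanded into exponentials
  by means of yw = y - 1 + s and y/w = y - 1 - s. In this form no logarithm and no division by
  \<open>y\<close> remain.\<close>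

definition denom_fps :: "complex \<Rightarrow> complex \<Rightarrow> complex fps" where
  "denom_fps y s = fps_const y + fps_const ((y - 1 + s) / 2) * fps_exp s +
     fps_const ((y - 1 - s) / 2) * fps_exp (- s)"

lemma fps_deriv_denom_fps:
  "fps_deriv (denom_fps y s) = fps_const (s * (y - 1 + s) / 2) * fps_exp s -
     fps_const (s * (y - 1 - s) / 2) * fps_exp (- s)"
  by (rule fps_ext) (simp add: denom_fps_def field_simps del: of_nat_Suc)

lemma fps_deriv2_denom_fps:
  "fps_deriv (fps_deriv (denom_fps y s)) = fps_const (s ^ 2) * (denom_fps y s - fps_const y)"
  unfolding fps_deriv_denom_fps
  by (rule fps_ext) (simp add: denom_fps_def power2_eq_square field_simps del: of_nat_Suc)

lemma shelf_fps_mult_denom_fps: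
  assumes s: "s ^ 2 = 1 - 2 * y"
  shows "shelf_fps y * denom_fps y s = fps_const (2 * y - 1)"
proof -
  define B L D c q where defs: "B = shelf_fps y" "L = left_shelf_fps y" "D = denom_fps y s"
    "c = fps_const y" "q = fps_const (1 - 2 * y)"
  have B': "fps_deriv B = L * B" and L': "fps_deriv L = c * B"
    by (simp_all add: defs fps_deriv_shelf_fps fps_deriv_left_shelf_fps)
  have D'': "fps_deriv (fps_deriv D) = q * (D - c)"
    by (simp only: defs fps_deriv2_denom_fps s)
  have q': "fps_deriv q = 0" by (simp add: defs)
  have L2: "L * L = 2 * c * B + q"
    using left_shelf_fps_square[of y]
    by (simp add: defs power2_eq_square flip: fps_const_mult numeral_fps_const)
  let ?G = "B * D + q" and ?F = "L * D + fps_deriv D"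
  have "fps_deriv ?G = 0 * ?G + B * ?F"
    by (simp add: B' q' algebra_simps)
  moreover have "fps_deriv ?F = (- c) * ?G + L * ?F"
  proof -
    \<comment> \<open>The quadratic relation removes L^2; after that both sides of the equation for
      F' equal cBD + qD - cq + LD'.\<close>
    have "L * ?F = 2 * c * B * D + q * D + L * fps_deriv D"
      using L2 by (simp add: distrib_left flip: mult.assoc) (simp add: algebra_simps)
    then show ?thesis by (simp add: L' D'' algebra_simps)
  qed
  moreover have D0: "fps_nth D 0 = 2 * y - 1" "fps_nth (fps_deriv D) 0 = s ^ 2"
    unfolding defs(3) fps_deriv_denom_fps
    by (simp_all add: denom_fps_def power2_eq_square field_simps)
  \<comment> \<open>Since B and L have constant term 1, the initial values are (2y - 1) + (1 - 2y)
    for G and (2y - 1) + s^2 for F.\<close>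
  then have "fps_nth ?G 0 = 0" "fps_nth ?F 0 = 0"
    by (simp_all add: shelf_fps_nth_0 s defs(1,2,5) del: fps_deriv_nth)
  ultimately have "?G = 0" by (rule fps_linear_system_eq_0)
  then have "B * D = - q" by (simp add: eq_neg_iff_add_eq_0)
  also have "- q = fps_const (2 * y - 1)" by (simp add: defs)
  finally show ?thesis by (simp add: defs)
qed

section \<open>Evaluation of the denominator series\<close>

lemma fps_conv_radius_const_mult_exp:
  "fps_conv_radius (fps_const a * fps_exp b) = \<infinity>" for a b :: complex
  by (cases "a = 0") (simp_all add: fps_conv_radius_cmult_left)

lemma fps_conv_radius_add_eq_infinity:
  fixes f g :: "'a::{banach, real_normed_div_algebra} fps"
  assumes "fps_conv_radius f = \<infinity>" "fps_conv_radius g = \<infinity>"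
  shows "fps_conv_radius (f + g) = \<infinity>"
  using fps_conv_radius_add[of f g] assms by simp

text \<open>The product (y - 1 + s)(y - 1 - s) = y^2 shows that the argument w of the logarithm is
  nonzero and that its inverse is (y - 1 - s)/y. The logarithm enters only through
  \<open>exp (ln w) = w\<close>, so its branch does not affect the value.\<close>

lemma eval_denom_fps:
  assumes "y \<noteq> 0" and s: "s ^ 2 = 1 - 2 * y"
  shows "eval_fps (denom_fps y s) z = y * cosh (z * s + ln (1 / y * (y + s - 1))) + y"
proof -
  have prod: "(y - 1 + s) * (y - 1 - s) = y ^ 2"
    using s by (simp add: power2_eq_square algebra_simps)
  with assms(1) have nz: "y + s - 1 \<noteq> 0"
    by (metis add_diff_eq diff_add_eq mult_zero_left zero_eq_power2)
  define w where "w = 1 / y * (y + s - 1)"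
  have w: "exp (ln w) = w" "y * w = y - 1 + s" "y * inverse w = y - 1 - s"
    using nz assms(1) prod by (auto simp: w_def field_simps power2_eq_square)
  have "y * cosh (z * s + ln w) = (y * w * exp (z * s) + y * inverse w * exp (- (z * s))) / 2"
    unfolding cosh_def by (simp add: exp_add exp_minus exp_diff w scaleR_conv_of_real field_simps)
  also have "\<dots> = ((y - 1 + s) * exp (z * s) + (y - 1 - s) * exp (- (z * s))) / 2"
    by (simp only: w)
  finally have *: "y * cosh (z * s + ln w) + y =
      y + (y - 1 + s) / 2 * exp (s * z) + (y - 1 - s) / 2 * exp (- s * z)"
    by (simp add: add_divide_distrib mult.commute[of z])
  have "eval_fps (denom_fps y s) z =
      y + (y - 1 + s) / 2 * exp (s * z) + (y - 1 - s) / 2 * exp (- s * z)"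
    unfolding denom_fps_def
    by (simp add: eval_fps_add eval_fps_mult fps_conv_radius_const_mult_exp
        fps_conv_radius_add_eq_infinity)
  with * show ?thesis by (simp add: w_def)
qed

lemma fps_conv_radius_denom_fps: "fps_conv_radius (denom_fps y s) = \<infinity>"
  unfolding denom_fps_def
  by (intro fps_conv_radius_add_eq_infinity fps_conv_radius_const_mult_exp fps_conv_radius_const)

section \<open>Convergence for small z\<close>

lemma norm_shelf_poly_le:
  fixes y :: complex
  shows "norm (shelf_poly y n) \<le> shelf_poly (norm y) n"
  \<comment> \<open>Every shelf contributes a power of \<open>y\<close> with coefficient 1, so the
    triangle inequality reduces complex estimates to real ones at \<open>norm y\<close>.\<close>
  unfolding shelf_poly_def shelf_weight_def by (rule sum_norm_le) (simp add: norm_power)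

lemma summable_shelf_poly:
  fixes y r :: real
  assumes "0 \<le> y" "0 \<le> r" "r * max 1 y < 1"
  shows "summable (\<lambda>n. shelf_poly y n / fact n * r ^ n)"
proof (rule summable_comparison_test')
  show "summable (\<lambda>n. (r * max 1 y) ^ n)"
    using assms by (intro summable_geometric) auto
next
  fix n
  have "shelf_poly y n / fact n \<le> max 1 y ^ n"
    using shelf_poly_le[of y "max 1 y" n] assms by (simp add: field_simps)
  then have "shelf_poly y n / fact n * r ^ n \<le> max 1 y ^ n * r ^ n"
    using assms by (intro mult_right_mono) auto
  then show "norm (shelf_poly y n / fact n * r ^ n) \<le> (r * max 1 y) ^ n"
    using assms shelf_poly_nonneg[of y n] by (simp add: power_mult_distrib mult.commute)
qed

lemma summable_norm_shelf_fps:
  assumes "norm z * max 1 (norm y) < 1"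
  shows "summable (\<lambda>n. norm (fps_nth (shelf_fps y) n * z ^ n))"
proof (rule summable_comparison_test')
  show "summable (\<lambda>n. shelf_poly (norm y) n / fact n * norm z ^ n)"
    using assms by (intro summable_shelf_poly) auto
  show "norm (norm (fps_nth (shelf_fps y) n * z ^ n)) \<le> shelf_poly (norm y) n / fact n * norm z ^ n" for n
    using norm_shelf_poly_le[of y n]
    by (auto simp: shelf_fps_def norm_mult norm_divide norm_power intro!: mult_right_mono divide_right_mono)
qed

lemma less_fps_conv_radius_shelf_fps:
  assumes "norm z * max 1 (norm y) < 1"
  shows "norm z < fps_conv_radius (shelf_fps y)"
proof -
  have "ereal (1 / max 1 (norm y)) \<le> fps_conv_radius (shelf_fps y)"
    \<comment> \<open>The radius can be tested at positive real points, where the geometric bound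
      already gives absolute summability.\<close>
    unfolding fps_conv_radius_def
  proof (rule conv_radius_geI_ex')
    fix r assume "0 < r" "ereal r < ereal (1 / max 1 (norm y))"
    then have "norm (complex_of_real r) * max 1 (norm y) < 1" by (simp add: field_simps)
    then show "summable (\<lambda>n. fps_nth (shelf_fps y) n * of_real r ^ n)"
      by (intro summable_norm_cancel[OF summable_norm_shelf_fps])
  qed
  moreover have "ereal (norm z) < ereal (1 / max 1 (norm y))"
    using assms by (simp add: field_simps)
  ultimately show ?thesis by (rule less_le_trans[rotated])
qed

section \<open>Summation over pairs of size and number of left children\<close>

lemma has_sum_e:
  fixes y c :: "'a::real_normed_field"
  shows "((\<lambda>k. of_nat (e n k) * (c * y ^ k / fact n)) has_sum (shelf_poly y n / fact n * c)) UNIV"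
proof (rule has_sum_finite_neutralI)
  show "shelf_poly y n / fact n * c =
      (\<Sum>k\<in>left_children ` BP n. of_nat (e n k) * (c * y ^ k / fact n))"
    unfolding sum_e_eq_shelf_poly[symmetric] sum_divide_distrib sum_distrib_right
    by (intro sum.cong) (simp_all add: field_simps)
qed (auto simp: e_eq_0 finite_BP)

lemma has_sum_shelf_fps:
  assumes "norm z * max 1 (norm y) < 1"
  shows "((\<lambda>(n, k). of_nat (e n k) * (z ^ n * y ^ k / fact n)) has_sum eval_fps (shelf_fps y) z)
    (UNIV :: (nat \<times> nat) set)"
proof -
  let ?f = "\<lambda>(n, k). of_nat (e n k) * (z ^ n * y ^ k / fact n)"
  \<comment> \<open>The norms of the terms are the same terms taken at \<open>norm y\<close> and
    \<open>norm z\<close>, so the real instance of the row sum applies.\<close>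
  have norm_sum: "((\<lambda>k. norm (?f (n, k))) has_sum (shelf_poly (norm y) n / fact n * norm z ^ n)) UNIV" for n
    using has_sum_e[of n "norm z ^ n" "norm y"] by (simp add: norm_mult norm_divide norm_power)
  have "(\<lambda>p. norm (?f p)) summable_on (UNIV \<times> UNIV)"
    unfolding Infinite_Sum.abs_summable_on_Sigma_iff
  proof (intro conjI ballI)
    show "(\<lambda>k. norm (?f (n, k))) summable_on UNIV" for n
      using norm_sum[of n] by (auto simp: summable_on_def)
    have "summable (\<lambda>n. shelf_poly (norm y) n / fact n * norm z ^ n)"
      using assms by (intro summable_shelf_poly) auto
    then show "(\<lambda>n. norm (\<Sum>\<^sub>\<infinity>k. norm (?f (n, k)))) summable_on UNIV"
      unfolding infsumI[OF norm_sum]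
      using shelf_poly_nonneg[of "norm y"]
      by (subst summable_on_UNIV_nonneg_real_iff) auto
  qed
  then have "?f summable_on (UNIV \<times> UNIV)" by (rule abs_summable_summable)
  moreover have "((\<lambda>n. fps_nth (shelf_fps y) n * z ^ n) has_sum eval_fps (shelf_fps y) z) UNIV"
    by (intro norm_summable_imp_has_sum summable_norm_shelf_fps sums_eval_fps
        less_fps_conv_radius_shelf_fps assms)
  moreover have "((\<lambda>k. ?f (n, k)) has_sum (fps_nth (shelf_fps y) n * z ^ n)) UNIV" for n
    using has_sum_e[of n "z ^ n" y] by (simp add: shelf_fps_def)
  ultimately show ?thesis
    using has_sum_SigmaI[where A = UNIV and f = ?f and B = "\<lambda>_. UNIV" and
        g = "\<lambda>n. fps_nth (shelf_fps y) n * z ^ n"] by simp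
qed

theorem theorem4:
  fixes y z :: complex
  assumes "y \<noteq> 0" and "y \<noteq> 1 / 2" and "norm z * max 1 (norm y) < 1"
  shows "y * cosh (z * csqrt (1 - 2 * y) + ln (1 / y * (y + csqrt (1 - 2 * y) - 1))) + y \<noteq> 0 \<and>
    ((\<lambda>(n, k). of_nat (e n k) * (z ^ n * y ^ k / fact n)) has_sum
       (2 * y - 1) /
         (y * cosh (z * csqrt (1 - 2 * y) + ln (1 / y * (y + csqrt (1 - 2 * y) - 1))) + y))
      (UNIV :: (nat \<times> nat) set)"
proof -
  define s where "s = csqrt (1 - 2 * y)"
  define D where "D = y * cosh (z * s + ln (1 / y * (y + s - 1))) + y"
  have s: "s ^ 2 = 1 - 2 * y" by (simp add: s_def)
  have "eval_fps (shelf_fps y) z * D = eval_fps (shelf_fps y * denom_fps y s) z"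
    unfolding D_def eval_denom_fps[OF assms(1) s, symmetric]
    using less_fps_conv_radius_shelf_fps[OF assms(3)]
    by (subst eval_fps_mult) (simp_all add: fps_conv_radius_denom_fps)
  then have *: "eval_fps (shelf_fps y) z * D = 2 * y - 1"
    by (simp add: shelf_fps_mult_denom_fps[OF s])
  moreover have "2 * y - 1 \<noteq> 0" using assms(2) by (auto simp: field_simps)
  ultimately have "D \<noteq> 0" by auto
  with * have "eval_fps (shelf_fps y) z = (2 * y - 1) / D" by (simp add: field_simps)
  with \<open>D \<noteq> 0\<close> has_sum_shelf_fps[OF assms(3)] show ?thesis
    by (simp add: D_def s_def)
qed

end
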